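(* Let $P$ be either the poset $2^X$ of all subsets of a finite set $X$ ordered by inclusion, or a totally ordered set $\{1<2<\cdots<N\}$ with $N\ge1$, and let $\mu$ be a probability measure on $P$. Suppose that $E_n(f_1,\ldots,f_n)\ge 0$ for every integer $n\ge1$ and all nonnegative monotone nondecreasing functions $f_1,\ldots,f_n:P\to\mathbb{R}$. Then, for every sequence $(p_i)_{i\ge1}$ of nonnegative monotone nondecreasing functions $p_i:P\to\mathbb{R}$, setting $p(A)=p_1(A)t+p_2(A)t^2+\cdots\in\mathbb{R}[[t]]$ for $A\in P$, all coefficients of the formal power series $$1-\prod_{A\in P}(1-p(A))^{\mu(A)}\in\mathbb{R}[[t]]$$ are nonnegative.
   Context: For a function $f:P\to\mathbb{R}$, write $\langle f\rangle_\mu=\sum_{A\in P}\mu(A)f(A)$. Given $f_1,\ldots,f_n:P\to\mathbb{R}$ and $\delta\subseteq[n]=\{1,\ldots,n\}$, put $E_\delta=\left\langle\prod_{i\in\delta}f_i\right\rangle_\mu$. For a set partition $\sigma=\{\sigma_1,\ldots,\sigma_\ell\}$ of $[n]$ into disjoint nonempty subsets, put $E_\sigma=\prod_{i=1}^{\ell}E_{\sigma_i}$, and let $\lambda(\sigma)=(\lambda_1,\ldots,\lambda_\ell)$ be the integer partition of $n$ formed by the block sizes $\lambda_i=|\sigma_i|$, with the blocks indexed so that $\lambda_1\ge\cdots\ge\lambda_\ell$. For an integer partition $\lambda=(\lambda_1,\ldots,\lambda_\ell)$ of $n$ (written $\lambda\vdash n$), put $E_\lambda=\sum_{\sigma:\,\lambda(\sigma)=\lambda}E_\sigma$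 and $c_\lambda=(-1)^{\ell+1}\prod_{i=1}^{\ell}(\lambda_i-1)!$. Define $E_n(f_1,\ldots,f_n)=\sum_{\lambda\vdash n}c_\lambda E_\lambda$. For a formal power series $q\in\mathbb{R}[[t]]$ with zero constant term and a real number $a$, the power $(1-q)^a$ is the formal power series $\exp(a\ln(1-q))$, where $\ln(1-q)=-\sum_{i\ge1}q^i/i$. *)

theory Defs
  imports
    "HOL-Probability.Probability_Mass_Function"
    "HOL-Library.Disjoint_Sets"
    "HOL-Library.Multiset"
    "HOL-Computational_Algebra.Formal_Power_Series"
begin

(* A finite poset is a set P of elements of an order type, with the induced order; a probability
   measure on P is a pmf mu with set_pmf mu \<subseteq> P.  The values of functions outside P are
   irrelevant. *)

definition nonneg_mono_on :: "'b::order set \<Rightarrow> ('b \<Rightarrow> real) \<Rightarrow> bool" where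
  "nonneg_mono_on P f \<longleftrightarrow> (\<forall>A\<in>P. 0 \<le> f A) \<and> mono_on P f"

definition avg :: "'b set \<Rightarrow> 'b pmf \<Rightarrow> ('b \<Rightarrow> real) \<Rightarrow> real" where
  "avg P \<mu> f = (\<Sum>A\<in>P. pmf \<mu> A * f A)"

definition E_block :: "'b set \<Rightarrow> 'b pmf \<Rightarrow> (nat \<Rightarrow> 'b \<Rightarrow> real) \<Rightarrow> nat set \<Rightarrow> real" where
  "E_block P \<mu> f \<delta> = avg P \<mu> (\<lambda>A. \<Prod>i\<in>\<delta>. f i A)"

definition E_setpart :: "'b set \<Rightarrow> 'b pmf \<Rightarrow> (nat \<Rightarrow> 'b \<Rightarrow> real) \<Rightarrow> nat set set \<Rightarrow> real" where
  "E_setpart P \<mu> f \<sigma> = (\<Prod>\<delta>\<in>\<sigma>. E_block P \<mu> f \<delta>)"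

(* Integer partitions are weakly decreasing lists of positive integers. *)
definition int_partitions :: "nat \<Rightarrow> nat list set" where
  "int_partitions n = {l. sorted_wrt (\<ge>) l \<and> (\<forall>k\<in>set l. 1 \<le> k) \<and> sum_list l = n}"

lemma finite_int_partitions: "finite (int_partitions n)"
proof (rule finite_subset)
  have "length l \<le> sum_list l" if "\<forall>k\<in>set l. 1 \<le> k" for l :: "nat list"
    using that by (induction l) auto
  then show "int_partitions n \<subseteq> {l. set l \<subseteq> {..n} \<and> length l \<le> n}"
    by (auto simp: int_partitions_def member_le_sum_list)
  show "finite {l. set l \<subseteq> {..n} \<and> length l \<le> n}"
    by (rule finite_lists_length_le) simp
qed

definition block_sizes :: "nat set set \<Rightarrow> nat list" where
  "block_sizes \<sigma> = rev (sorted_list_of_multiset (image_mset card (mset_set \<sigma>)))"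

definition E_intpart ::
  "'b set \<Rightarrow> 'b pmf \<Rightarrow> nat \<Rightarrow> (nat \<Rightarrow> 'b \<Rightarrow> real) \<Rightarrow> nat list \<Rightarrow> real" where
  "E_intpart P \<mu> n f l =
     (\<Sum>\<sigma> | partition_on {1..n} \<sigma> \<and> block_sizes \<sigma> = l. E_setpart P \<mu> f \<sigma>)"

definition c_coeff :: "nat list \<Rightarrow> real" where
  "c_coeff l = (-1) ^ (length l + 1) * (\<Prod>i<length l. fact (l ! i - 1))"

(* E_n(f_1, ..., f_n); only the entries f 1, ..., f n of the sequence f are used. *)
definition E_corr :: "'b set \<Rightarrow> 'b pmf \<Rightarrow> nat \<Rightarrow> (nat \<Rightarrow> 'b \<Rightarrow> real) \<Rightarrow> real" where
  "E_corr P \<mu> n f = (\<Sum>l\<in>int_partitions n. c_coeff l * E_intpart P \<mu> n f l)"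

definition all_E_nonneg :: "'b::order set \<Rightarrow> 'b pmf \<Rightarrow> bool" where
  "all_E_nonneg P \<mu> \<longleftrightarrow>
     (\<forall>n\<ge>1. \<forall>f. (\<forall>i\<in>{1..n}. nonneg_mono_on P (f i)) \<longrightarrow> 0 \<le> E_corr P \<mu> n f)"

(* ln (1 - q) = - (\<Sum>i\<ge>1. q^i / i), meaningful when q has zero constant term: the infinite sum is
   then composition of power series. *)
definition fps_ln_one_minus :: "real fps \<Rightarrow> real fps" where
  "fps_ln_one_minus q = - (Abs_fps (\<lambda>i. if i = 0 then 0 else 1 / real i) oo q)"

(* (1 - q) ^ a for q with zero constant term. *)
definition fps_one_minus_powr :: "real fps \<Rightarrow> real \<Rightarrow> real fps" where
  "fps_one_minus_powr q a = fps_exp 1 oo (fps_const a * fps_ln_one_minus q)"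

(* p_1(A) t + p_2(A) t^2 + ...; the entry p 0 is not used. *)
definition gen_series :: "(nat \<Rightarrow> 'b \<Rightarrow> real) \<Rightarrow> 'b \<Rightarrow> real fps" where
  "gen_series p A = Abs_fps (\<lambda>i. if i = 0 then 0 else p i A)"

end

theory Submission
  imports Defs
begin

text \<open>
  Write \<open>a\<^sub>k\<close> for the average of \<open>p\<^sup>k\<close>.  The product \<open>\<Prod> (1 - p(A))\<^bsup>\<mu>(A)\<^esup>\<close> is
  \<open>exp (- (\<Sum>k\<ge>1. a\<^sub>k / k))\<close>, and in its expansion the part of degree \<open>n\<close> in \<open>p\<close> is
  \<open>1 / n!\<close> times the sum over all permutations of \<open>n\<close> points of the product, over their cycles,
  of \<open>- a\<^sub>k\<close> for a cycle of length \<open>k\<close>.  Since \<open>(k - 1)!\<close> cyclic orders live on a block of size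
  \<open>k\<close>, this sum is \<open>- E\<^sub>n(p, ..., p)\<close>.  Because \<open>E\<^sub>n\<close> is multilinear, every coefficient of
  \<open>1 - \<Prod> (1 - p(A))\<^bsup>\<mu>(A)\<^esup>\<close> is a sum, with factors \<open>1 / n!\<close>, of numbers
  \<open>E\<^sub>n(p\<^sub>i, p\<^sub>j, ...)\<close>, all of which are nonnegative by hypothesis.  The argument works on any
  finite poset (\<open>all_E_nonneg_imp_coeffs_nonneg\<close>).

  To make multilinearity visible, \<open>- E\<^sub>n\<close> is rewritten as a sum over maps \<open>c\<close> that send each index
  \<open>i\<close> to the point where \<open>f i\<close> is evaluated (\<open>point_expansion\<close>): grouping the permutations whose
  cycles are labelled by points according to \<open>c\<close>, the points decouple, and \<open>A\<close> contributes the
  sum of \<open>(- \<mu>(A))\<close> to the number of cycles over the permutations of the fibre of \<open>A\<close>, which is a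
  rising factorial.  Both forms satisfy the same recursion under adding one index, so they agree
  (\<open>point_expansion_insert\<close>, \<open>point_expansion_eq_partition_sum\<close>, \<open>E_corr_eq_point_expansion\<close>).
  The expansion makes sense over every commutative ring.  Over power series it yields
  the parts of degree \<open>n\<close> in \<open>p\<close>, whose coefficients are real expansions
  (\<open>fps_nth_point_expansion\<close>) and whose sum satisfies the same linear differential equation as
  the product of powers (\<open>fps_nth_prod_one_minus_powr\<close>).
\<close>

section \<open>Expansion over the points of the poset\<close>

text \<open>
  The sum over permutations \<open>\<pi>\<close> of \<open>S\<close> with \<open>c\<close> constant on cycles of \<open>\<Prod> (- m A)\<close>, one factor for
  each cycle, \<open>A\<close> being the value of \<open>c\<close> on it.
\<close>

definition rising_weight :: "'b set \<Rightarrow> ('b \<Rightarrow> 'r::comm_ring_1) \<Rightarrow> 'i set \<Rightarrow> ('i \<Rightarrow> 'b) \<Rightarrow> 'r" where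
  "rising_weight P m S c = (\<Prod>A\<in>P. pochhammer (- m A) (card {i\<in>S. c i = A}))"

definition point_expansion ::
  "'b set \<Rightarrow> ('b \<Rightarrow> 'r::comm_ring_1) \<Rightarrow> 'i set \<Rightarrow> ('i \<Rightarrow> 'b \<Rightarrow> 'r) \<Rightarrow> 'r" where
  "point_expansion P m S f =
     (\<Sum>c\<in>S \<rightarrow>\<^sub>E P. rising_weight P m S c * (\<Prod>i\<in>S. f i (c i)))"

lemma point_expansion_empty [simp]: "point_expansion P m {} f = 1"
  by (simp add: point_expansion_def rising_weight_def)

lemma point_expansion_cong:
  assumes "\<And>i A. i \<in> S \<Longrightarrow> A \<in> P \<Longrightarrow> f i A = g i A"
  shows "point_expansion P m S f = point_expansion P m S g"
  unfolding point_expansion_def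
  by (intro sum.cong refl arg_cong2[where f = "(*)"] prod.cong) (use assms in \<open>auto simp: PiE_iff\<close>)

text \<open>
  A new element with label \<open>A\<close> either starts a cycle of its own, at the price \<open>- m A\<close>, or is
  inserted after one of the elements labelled \<open>A\<close> in an existing cycle.
\<close>

lemma rising_weight_insert:
  assumes "finite P" "finite S" "x \<notin> S" "A \<in> P"
  shows "rising_weight P m (insert x S) (c(x := A)) =
    rising_weight P m S c * (of_nat (card {i\<in>S. c i = A}) - m A)"
proof -
  define k where "k B = card {i\<in>S. c i = B}" for B
  have *: "{i\<in>insert x S. (c(x := A)) i = B} = (if B = A then insert x {i\<in>S. c i = B} else {i\<in>S. c i = B})" for B
    using assms by auto
  have "card {i\<in>insert x S. (c(x := A)) i = B} = (if B = A then Suc (k B) else k B)" for B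
    unfolding * k_def using assms by auto
  then have "rising_weight P m (insert x S) (c(x := A)) =
      (\<Prod>B\<in>P. pochhammer (- m B) (if B = A then Suc (k B) else k B))"
    unfolding rising_weight_def by simp
  also have "\<dots> = pochhammer (- m A) (Suc (k A)) * (\<Prod>B\<in>P-{A}. pochhammer (- m B) (k B))"
    using assms by (subst prod.remove[where x = A]) (auto intro!: prod.cong)
  also have "\<dots> = (\<Prod>B\<in>P. pochhammer (- m B) (k B)) * (of_nat (k A) - m A)"
    using assms by (subst (2) prod.remove[where x = A]) (auto simp: pochhammer_Suc algebra_simps)
  finally show ?thesis
    unfolding rising_weight_def k_def .
qed

lemma prod_absorb:
  fixes f :: "'i \<Rightarrow> 'r::comm_monoid_mult"
  assumes "finite S" "j \<in> S"
  shows "(\<Prod>i\<in>S. (if i = j then a * f i else f i)) = a * (\<Prod>i\<in>S. f i)"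
proof -
  have "(\<Prod>i\<in>S. (if i = j then a * f i else f i)) = (\<Prod>i\<in>S. (if i = j then a else 1) * f i)"
    by (rule prod.cong) auto
  then show ?thesis
    using assms by (simp add: prod.distrib prod.delta)
qed

text \<open>
  The alternative of \<open>rising_weight_insert\<close> in terms of functions: a cycle of its own splits off
  the average of \<open>f x\<close>, and insertion after \<open>j\<close> merges \<open>f x\<close> into \<open>f j\<close>.  This recursion
  determines the expansion.
\<close>

lemma point_expansion_insert:
  assumes "finite P" "finite S" "x \<notin> S"
  shows "point_expansion P m (insert x S) f =
    - (\<Sum>A\<in>P. m A * f x A) * point_expansion P m S f
    + (\<Sum>j\<in>S. point_expansion P m S (f(j := \<lambda>A. f x A * f j A)))"
proof -
  define W where "W = rising_weight P m S"
  define F where "F c = (\<Prod>i\<in>S. f i (c i))" for c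
  have fin: "finite (S \<rightarrow>\<^sub>E P)"
    using assms by (simp add: finite_PiE)
  have "point_expansion P m (insert x S) f =
      (\<Sum>(A, c)\<in>P \<times> (S \<rightarrow>\<^sub>E P). rising_weight P m (insert x S) (c(x := A)) *
         (\<Prod>i\<in>insert x S. f i ((c(x := A)) i)))"
    unfolding point_expansion_def PiE_insert_eq
    by (subst sum.reindex) (use inj_combinator[OF assms(3)] in \<open>auto intro!: sum.cong\<close>)
  also have "\<dots> = (\<Sum>(A, c)\<in>P \<times> (S \<rightarrow>\<^sub>E P).
      W c * (of_nat (card {i\<in>S. c i = A}) - m A) * (f x A * F c))"
  proof (intro sum.cong refl, clarify)
    fix A c assume "A \<in> P"
    have "(\<Prod>i\<in>insert x S. f i ((c(x := A)) i)) = f x A * F c"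
      using assms by (auto simp: F_def intro!: arg_cong2[where f = "(*)"] prod.cong)
    then show "rising_weight P m (insert x S) (c(x := A)) * (\<Prod>i\<in>insert x S. f i ((c(x := A)) i)) =
        W c * (of_nat (card {i\<in>S. c i = A}) - m A) * (f x A * F c)"
      using rising_weight_insert[OF assms \<open>A \<in> P\<close>, of m c] by (simp only: W_def)
  qed
  also have "\<dots> = (\<Sum>c\<in>S \<rightarrow>\<^sub>E P. \<Sum>A\<in>P. W c * (of_nat (card {i\<in>S. c i = A}) - m A) * (f x A * F c))"
    by (subst sum.swap) (simp add: sum.cartesian_product)
  also have "\<dots> = (\<Sum>c\<in>S \<rightarrow>\<^sub>E P. - (\<Sum>A\<in>P. m A * f x A) * (W c * F c) + (\<Sum>j\<in>S. f x (c j) * (W c * F c)))"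
  proof (intro sum.cong refl)
    fix c assume c: "c \<in> S \<rightarrow>\<^sub>E P"
    have "(\<Sum>A\<in>P. of_nat (card {i\<in>S. c i = A}) * f x A) = (\<Sum>A\<in>P. \<Sum>i\<in>{i\<in>S. c i = A}. f x (c i))"
      by (intro sum.cong refl) auto
    also have "\<dots> = (\<Sum>j\<in>S. f x (c j))"
      by (rule sum.group) (use assms c in auto)
    finally have "(\<Sum>A\<in>P. of_nat (card {i\<in>S. c i = A}) * f x A) = (\<Sum>j\<in>S. f x (c j))" .
    then have "- (\<Sum>A\<in>P. m A * f x A) * (W c * F c) + (\<Sum>j\<in>S. f x (c j) * (W c * F c)) =
        ((\<Sum>A\<in>P. of_nat (card {i\<in>S. c i = A}) * f x A) - (\<Sum>A\<in>P. m A * f x A)) * (W c * F c)"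
      by (simp add: sum_distrib_right[symmetric] left_diff_distrib)
    also have "\<dots> = (\<Sum>A\<in>P. W c * (of_nat (card {i\<in>S. c i = A}) - m A) * (f x A * F c))"
      unfolding sum_subtractf[symmetric] sum_distrib_right
      by (intro sum.cong refl) (simp add: algebra_simps)
    finally show "(\<Sum>A\<in>P. W c * (of_nat (card {i\<in>S. c i = A}) - m A) * (f x A * F c)) =
      - (\<Sum>A\<in>P. m A * f x A) * (W c * F c) + (\<Sum>j\<in>S. f x (c j) * (W c * F c))" by simp
  qed
  also have "\<dots> = - (\<Sum>A\<in>P. m A * f x A) * (\<Sum>c\<in>S \<rightarrow>\<^sub>E P. W c * F c)
      + (\<Sum>j\<in>S. \<Sum>c\<in>S \<rightarrow>\<^sub>E P. f x (c j) * (W c * F c))"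
    by (simp only: sum.distrib sum_distrib_left
        sum.swap[of "\<lambda>c j. f x (c j) * (W c * F c)" S "S \<rightarrow>\<^sub>E P"])
  also have "(\<Sum>j\<in>S. \<Sum>c\<in>S \<rightarrow>\<^sub>E P. f x (c j) * (W c * F c)) =
      (\<Sum>j\<in>S. point_expansion P m S (f(j := \<lambda>A. f x A * f j A)))"
    unfolding point_expansion_def
  proof (intro sum.cong refl)
    fix j c assume "j \<in> S"
    have "(\<Prod>i\<in>S. (f(j := \<lambda>A. f x A * f j A)) i (c i)) =
        (\<Prod>i\<in>S. if i = j then f x (c j) * f i (c i) else f i (c i))"
      by (intro prod.cong refl) auto
    then show "f x (c j) * (W c * F c) =
        rising_weight P m S c * (\<Prod>i\<in>S. (f(j := \<lambda>A. f x A * f j A)) i (c i))"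
      using prod_absorb[OF \<open>finite S\<close> \<open>j \<in> S\<close>, of "f x (c j)" "\<lambda>i. f i (c i)"]
      by (simp add: W_def F_def ac_simps)
  qed
  also have "(\<Sum>c\<in>S \<rightarrow>\<^sub>E P. W c * F c) = point_expansion P m S f"
    by (simp add: point_expansion_def W_def F_def)
  finally show ?thesis .
qed

section \<open>Sums over set partitions\<close>

text \<open>
  Removing \<open>x\<close> from a partition of \<open>insert x S\<close> either deletes the block \<open>{x}\<close> or shrinks a larger
  block; the two kinds of partitions are the sets \<open>Q1\<close> and \<open>Q2\<close> of the proof.
\<close>

lemma sum_partition_on_insert:
  fixes w :: "'i set set \<Rightarrow> 'r::comm_monoid_add"
  assumes "finite S" "x \<notin> S"
  shows "(\<Sum>\<sigma> | partition_on (insert x S) \<sigma>. w \<sigma>) =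
    (\<Sum>\<sigma> | partition_on S \<sigma>. w (insert {x} \<sigma>) + (\<Sum>\<delta>\<in>\<sigma>. w (insert (insert x \<delta>) (\<sigma> - {\<delta>}))))"
proof -
  let ?grow = "\<lambda>(\<sigma>, \<delta>). insert (insert x \<delta>) (\<sigma> - {\<delta>})"
  define Q where "Q = {\<sigma>. partition_on S \<sigma>}"
  define Q1 where "Q1 = insert {x} ` Q"
  define Q2 where "Q2 = ?grow ` (SIGMA \<sigma>:Q. \<sigma>)"
  have finQ: "finite Q"
    unfolding Q_def using assms(1) by (rule finitely_many_partition_on)
  have finB: "finite \<sigma>" if "\<sigma> \<in> Q" for \<sigma>
    using that assms(1) finite_elements unfolding Q_def by blast
  have x: "x \<notin> B" if "\<sigma> \<in> Q" "B \<in> \<sigma>" for \<sigma> B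
    using that assms(2) by (auto simp: Q_def partition_on_def)
  have inj1: "inj_on (insert {x}) Q"
    by (rule inj_on_inverseI[where g = "\<lambda>\<sigma>. \<sigma> - {{x}}"]) (use x in blast)
  have inj2: "inj_on ?grow (SIGMA \<sigma>:Q. \<sigma>)"
  proof (rule inj_onI, clarify)
    fix \<sigma> \<delta> \<sigma>' \<delta>'
    assume *: "\<sigma> \<in> Q" "\<delta> \<in> \<sigma>" "\<sigma>' \<in> Q" "\<delta>' \<in> \<sigma>'"
      and eq: "insert (insert x \<delta>) (\<sigma> - {\<delta>}) = insert (insert x \<delta>') (\<sigma>' - {\<delta>'})"
    have "{B \<in> insert (insert x \<delta>) (\<sigma> - {\<delta>}). x \<in> B} = {insert x \<delta>}"
      "{B \<in> insert (insert x \<delta>') (\<sigma>' - {\<delta>'}). x \<in> B} = {insert x \<delta>'}"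
      using x[OF *(1)] x[OF *(3)] by blast+
    with eq have "insert x \<delta> = insert x \<delta>'"
      by simp
    then have 1: "\<delta> = \<delta>'"
      using x * by (metis insert_ident)
    have "\<sigma> - {\<delta>} = {B \<in> insert (insert x \<delta>) (\<sigma> - {\<delta>}). x \<notin> B}"
      "\<sigma>' - {\<delta>'} = {B \<in> insert (insert x \<delta>') (\<sigma>' - {\<delta>'}). x \<notin> B}"
      using x[OF *(1)] x[OF *(3)] by blast+
    with eq have "\<sigma> - {\<delta>} = \<sigma>' - {\<delta>'}"
      by simp
    with 1 * show "\<sigma> = \<sigma>' \<and> \<delta> = \<delta>'" by blast
  qed
  have disj: "Q1 \<inter> Q2 = {}"
  proof -
    have "{x} \<notin> \<tau>" if "\<tau> \<in> Q2" for \<tau>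
    proof -
      from that obtain \<sigma> \<delta> where *: "\<sigma> \<in> Q" "\<delta> \<in> \<sigma>" "\<tau> = insert (insert x \<delta>) (\<sigma> - {\<delta>})"
        by (auto simp: Q2_def)
      have "\<delta> \<noteq> {}"
        using *(1,2) by (auto simp: Q_def partition_on_def)
      with * x[OF *(1)] show ?thesis by blast
    qed
    then show ?thesis by (auto simp: Q1_def)
  qed
  have "{\<sigma>. partition_on (insert x S) \<sigma>} = Q1 \<union> Q2"
  proof (intro equalityI subsetI)
    fix \<tau> assume "\<tau> \<in> {\<sigma>. partition_on (insert x S) \<sigma>}"
    then have \<tau>: "\<Union>\<tau> = insert x S" "disjoint \<tau>" "{} \<notin> \<tau>"
      by (auto simp: partition_on_def)
    then obtain B where B: "B \<in> \<tau>" "x \<in> B" by blast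
    have other: "disjnt B C" if "C \<in> \<tau>" "C \<noteq> B" for C
      using \<tau>(2) that B(1) by (auto simp: pairwise_def)
    have \<tau>B: "\<tau> = insert B (\<tau> - {B})" using B by blast
    have dB: "disjnt B (\<Union>(\<tau> - {B}))"
      using other by (auto simp: disjnt_iff)
    have pB: "partition_on (insert x S - B) (\<tau> - {B})"
      using partition_on_insert[OF dB, of "insert x S"] \<tau> unfolding \<tau>B[symmetric]
      by (simp add: partition_on_def)
    show "\<tau> \<in> Q1 \<union> Q2"
    proof (cases "B = {x}")
      case True
      with pB have "\<tau> - {B} \<in> Q"
        using assms(2) by (simp add: Q_def)
      moreover have "\<tau> = insert {x} (\<tau> - {B})"
        using True B(1) by blast
      ultimately show ?thesis
        unfolding Q1_def by blast
    next
      case False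
      have d: "disjnt (B - {x}) (\<Union>(\<tau> - {B}))"
        using dB by (auto simp: disjnt_iff)
      have "S - (B - {x}) = insert x S - B" using B assms(2) by blast
      then have "insert (B - {x}) (\<tau> - {B}) \<in> Q"
        unfolding Q_def mem_Collect_eq partition_on_insert[OF d] using pB B False \<tau>(1) by auto
      moreover have "B - {x} \<notin> \<tau> - {B}"
      proof
        assume "B - {x} \<in> \<tau> - {B}"
        then have "disjnt (B - {x}) (B - {x})"
          by (intro disjnt_subset2[OF d]) blast
        with False B show False by auto
      qed
      then have "\<tau> = ?grow (insert (B - {x}) (\<tau> - {B}), B - {x})"
        using B by (simp add: insert_absorb insert_Diff)
      ultimately show ?thesis
        unfolding Q2_def
        by (intro UnI2 image_eqI[of _ ?grow "(insert (B - {x}) (\<tau> - {B}), B - {x})"]) simp_all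
    qed
  next
    fix \<tau> assume "\<tau> \<in> Q1 \<union> Q2"
    then show "\<tau> \<in> {\<sigma>. partition_on (insert x S) \<sigma>}"
    proof
      assume "\<tau> \<in> Q1"
      then obtain \<sigma> where *: "\<sigma> \<in> Q" "\<tau> = insert {x} \<sigma>" by (auto simp: Q1_def)
      have "disjnt {x} (\<Union>\<sigma>)" using x[OF *(1)] by (auto simp: disjnt_iff)
      from partition_on_insert[OF this, of "insert x S"] show ?thesis
        using * assms(2) by (simp add: Q_def)
    next
      assume "\<tau> \<in> Q2"
      then obtain \<sigma> \<delta> where *: "\<sigma> \<in> Q" "\<delta> \<in> \<sigma>" "\<tau> = insert (insert x \<delta>) (\<sigma> - {\<delta>})"
        by (auto simp: Q2_def)
      have p: "partition_on S (insert \<delta> (\<sigma> - {\<delta>}))"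
        using * by (simp add: Q_def insert_absorb)
      have d: "disjnt \<delta> (\<Union>(\<sigma> - {\<delta>}))"
        using * by (auto simp: Q_def partition_on_def disjnt_iff pairwise_def)
      then have d': "disjnt (insert x \<delta>) (\<Union>(\<sigma> - {\<delta>}))"
        using x[OF *(1)] by (auto simp: disjnt_iff)
      have "insert x S - insert x \<delta> = S - \<delta>" using assms(2) by blast
      with p show ?thesis
        unfolding partition_on_insert[OF d] *(3) mem_Collect_eq partition_on_insert[OF d']
        by auto
    qed
  qed
  then have "(\<Sum>\<sigma> | partition_on (insert x S) \<sigma>. w \<sigma>) = sum w Q1 + sum w Q2"
    using finQ finB disj by (simp add: sum.union_disjoint Q1_def Q2_def)
  also have "sum w Q1 = (\<Sum>\<sigma>\<in>Q. w (insert {x} \<sigma>))"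
    unfolding Q1_def by (simp add: sum.reindex[OF inj1])
  also have "sum w Q2 = (\<Sum>\<sigma>\<in>Q. \<Sum>\<delta>\<in>\<sigma>. w (insert (insert x \<delta>) (\<sigma> - {\<delta>})))"
    unfolding Q2_def sum.reindex[OF inj2]
    by (simp add: sum.Sigma[OF finQ] finB case_prod_unfold comp_def)
  finally show ?thesis
    by (simp add: sum.distrib Q_def)
qed

text \<open>
  The factor \<open>fact (card \<delta> - 1)\<close> is the number of cyclic orders on \<open>\<delta>\<close>.  One minus sign per block
  turns the product over a partition into the negative of its term in \<open>E_corr\<close>.
\<close>

definition cycle_weight :: "'b set \<Rightarrow> ('b \<Rightarrow> real) \<Rightarrow> ('i \<Rightarrow> 'b \<Rightarrow> real) \<Rightarrow> 'i set \<Rightarrow> real" where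
  "cycle_weight P m f \<delta> = - fact (card \<delta> - 1) * (\<Sum>A\<in>P. m A * (\<Prod>i\<in>\<delta>. f i A))"

text \<open>
  For a block of size \<open>k\<close>, the factorial grows from \<open>(k - 1)!\<close> to \<open>k!\<close>, and the additional factor
  \<open>k\<close> is used up by the \<open>k\<close> equal terms on the right.
\<close>

lemma cycle_weight_insert:
  assumes "finite \<delta>" "\<delta> \<noteq> {}" "x \<notin> \<delta>"
  shows "cycle_weight P m f (insert x \<delta>) =
    (\<Sum>j\<in>\<delta>. cycle_weight P m (f(j := \<lambda>A. f x A * f j A)) \<delta>)"
proof -
  have "cycle_weight P m (f(j := \<lambda>A. f x A * f j A)) \<delta> =
      - fact (card \<delta> - 1) * (\<Sum>A\<in>P. m A * (f x A * (\<Prod>i\<in>\<delta>. f i A)))" if "j \<in> \<delta>" for j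
  proof -
    have "(\<Prod>i\<in>\<delta>. (f(j := \<lambda>A. f x A * f j A)) i A) = f x A * (\<Prod>i\<in>\<delta>. f i A)" for A
    proof -
      have "(\<Prod>i\<in>\<delta>. (f(j := \<lambda>A. f x A * f j A)) i A) =
          (\<Prod>i\<in>\<delta>. if i = j then f x A * f i A else f i A)"
        by (intro prod.cong refl) auto
      with prod_absorb[OF assms(1) that, of "f x A" "\<lambda>i. f i A"] show ?thesis by simp
    qed
    then show ?thesis by (simp only: cycle_weight_def)
  qed
  moreover have "fact (card \<delta>) = real (card \<delta>) * fact (card \<delta> - 1)"
    using assms by (intro fact_reduce) (simp add: card_gt_0_iff)
  ultimately show ?thesis
    using assms by (simp add: cycle_weight_def)
qed

text \<open>
  The sum over partitions satisfies the recursion of \<open>point_expansion_insert\<close>: the new index is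
  a singleton block or is merged with an index of an old block, and the merges, taken
  block by block, range over all old indices.
\<close>

lemma point_expansion_eq_partition_sum:
  fixes f :: "'i \<Rightarrow> 'b \<Rightarrow> real"
  assumes "finite P" "finite S"
  shows "point_expansion P m S f =
    (\<Sum>\<sigma> | partition_on S \<sigma>. \<Prod>\<delta>\<in>\<sigma>. cycle_weight P m f \<delta>)"
  using assms(2)
proof (induction S arbitrary: f rule: finite_induct)
  case empty
  show ?case by (simp add: partition_on_empty)
next
  case (insert x S)
  define u where "u j = f(j := \<lambda>A. f x A * f j A)" for j
  define w where "w g \<sigma> = (\<Prod>\<delta>\<in>\<sigma>. cycle_weight P m g \<delta>)" for g :: "'i \<Rightarrow> 'b \<Rightarrow> real" and \<sigma>
  have IH: "point_expansion P m S g = (\<Sum>\<sigma> | partition_on S \<sigma>. w g \<sigma>)" for g :: "'i \<Rightarrow> 'b \<Rightarrow> real"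
    using insert.IH by (simp add: w_def)
  have step: "w f (insert {x} \<sigma>) + (\<Sum>\<delta>\<in>\<sigma>. w f (insert (insert x \<delta>) (\<sigma> - {\<delta>}))) =
      - (\<Sum>A\<in>P. m A * f x A) * w f \<sigma> + (\<Sum>j\<in>S. w (u j) \<sigma>)"
    if "partition_on S \<sigma>" for \<sigma>
  proof -
    have \<sigma>: "finite \<sigma>" "\<Union>\<sigma> = S"
      using that insert.hyps finite_elements by (auto simp: partition_on_def)
    have disj: "\<delta> \<inter> \<gamma> = {}" if "\<delta> \<in> \<sigma>" "\<gamma> \<in> \<sigma>" "\<delta> \<noteq> \<gamma>" for \<delta> \<gamma>
      using \<open>partition_on S \<sigma>\<close> that by (auto simp: partition_on_def disjoint_def)
    have block: "finite \<delta>" "\<delta> \<noteq> {}" "x \<notin> \<delta>" if "\<delta> \<in> \<sigma>" for \<delta>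
      using \<open>partition_on S \<sigma>\<close> that insert.hyps \<sigma>(2) finite_subset[of \<delta> S]
      by (auto simp: partition_on_def)
    have "w f (insert {x} \<sigma>) = - (\<Sum>A\<in>P. m A * f x A) * w f \<sigma>"
      using \<sigma>(1) block(3) by (subst w_def, subst prod.insert) (auto simp: w_def cycle_weight_def)
    moreover have "w f (insert (insert x \<delta>) (\<sigma> - {\<delta>})) = (\<Sum>j\<in>\<delta>. w (u j) \<sigma>)" if \<delta>: "\<delta> \<in> \<sigma>" for \<delta>
    proof -
      have "insert x \<delta> \<notin> \<sigma>"
        using block(3) by blast
      then have "w f (insert (insert x \<delta>) (\<sigma> - {\<delta>})) =
          cycle_weight P m f (insert x \<delta>) * (\<Prod>\<gamma>\<in>\<sigma> - {\<delta>}. cycle_weight P m f \<gamma>)"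
        unfolding w_def using \<sigma>(1) by (subst prod.insert) auto
      also have "\<dots> = (\<Sum>j\<in>\<delta>. cycle_weight P m (u j) \<delta> * (\<Prod>\<gamma>\<in>\<sigma> - {\<delta>}. cycle_weight P m f \<gamma>))"
        using block[OF \<delta>] by (simp add: cycle_weight_insert u_def sum_distrib_right)
      also have "\<dots> = (\<Sum>j\<in>\<delta>. cycle_weight P m (u j) \<delta> * (\<Prod>\<gamma>\<in>\<sigma> - {\<delta>}. cycle_weight P m (u j) \<gamma>))"
      proof (intro sum.cong refl arg_cong2[where f = "(*)"] prod.cong)
        fix j \<gamma> assume "j \<in> \<delta>" "\<gamma> \<in> \<sigma> - {\<delta>}"
        then have "j \<notin> \<gamma>" using disj[OF \<delta>, of \<gamma>] by auto
        then have "(\<Prod>i\<in>\<gamma>. f i A) = (\<Prod>i\<in>\<gamma>. u j i A)" for A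
          by (intro prod.cong) (auto simp: u_def)
        then show "cycle_weight P m f \<gamma> = cycle_weight P m (u j) \<gamma>"
          by (simp add: cycle_weight_def)
      qed
      also have "\<dots> = (\<Sum>j\<in>\<delta>. w (u j) \<sigma>)"
        unfolding w_def using \<sigma>(1) \<delta> by (simp add: prod.remove)
      finally show ?thesis .
    qed
    moreover have "(\<Sum>j\<in>S. w (u j) \<sigma>) = (\<Sum>\<delta>\<in>\<sigma>. \<Sum>j\<in>\<delta>. w (u j) \<sigma>)"
      using sum.Union_disjoint[of \<sigma> "\<lambda>j. w (u j) \<sigma>"] block(1) disj \<sigma>(2) by auto
    ultimately show ?thesis by simp
  qed
  have "(\<Sum>\<sigma> | partition_on (insert x S) \<sigma>. w f \<sigma>) =
      (\<Sum>\<sigma> | partition_on S \<sigma>. - (\<Sum>A\<in>P. m A * f x A) * w f \<sigma> + (\<Sum>j\<in>S. w (u j) \<sigma>))"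
    unfolding sum_partition_on_insert[OF insert.hyps] by (intro sum.cong refl step) simp
  also have "\<dots> = - (\<Sum>A\<in>P. m A * f x A) * point_expansion P m S f
      + (\<Sum>j\<in>S. point_expansion P m S (u j))"
    unfolding IH by (simp only: sum.distrib sum_distrib_left
        sum.swap[of "\<lambda>\<sigma> j. w (u j) \<sigma>" S "{\<sigma>. partition_on S \<sigma>}"])
  also have "\<dots> = point_expansion P m (insert x S) f"
    unfolding u_def by (rule point_expansion_insert[OF assms(1) insert.hyps, symmetric])
  finally show ?case by (simp add: w_def)
qed

lemma mset_block_sizes: "mset (block_sizes \<sigma>) = image_mset card (mset_set \<sigma>)"
  by (simp add: block_sizes_def)

lemma block_sizes_int_partitions:
  assumes "partition_on {1..n} \<sigma>"
  shows "block_sizes \<sigma> \<in> int_partitions n"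
proof -
  have fin: "finite \<delta>" "\<delta> \<noteq> {}" if "\<delta> \<in> \<sigma>" for \<delta>
    using assms that finite_subset[of \<delta> "{1..n}"] by (auto simp: partition_on_def)
  have "sum_list (block_sizes \<sigma>) = (\<Sum>\<delta>\<in>\<sigma>. card \<delta>)"
    by (simp add: sum_mset_sum_list[symmetric] mset_block_sizes sum_unfold_sum_mset)
  also have "\<dots> = n"
    using product_partition[OF assms] fin by simp
  finally have "sum_list (block_sizes \<sigma>) = n" .
  moreover have "1 \<le> k" if "k \<in> set (block_sizes \<sigma>)" for k
  proof -
    have "k \<in># mset (block_sizes \<sigma>)" using that by simp
    then obtain \<delta> where "\<delta> \<in># mset_set \<sigma>" "k = card \<delta>"
      unfolding mset_block_sizes by auto
    then have "\<delta> \<in> \<sigma>" "k = card \<delta>"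
      by (cases "finite \<sigma>"; simp)+
    with fin[of \<delta>] show ?thesis by (simp add: Suc_le_eq card_gt_0_iff)
  qed
  moreover have "sorted_wrt (\<ge>) (block_sizes \<sigma>)"
    by (simp add: block_sizes_def sorted_wrt_rev)
  ultimately show ?thesis
    by (simp add: int_partitions_def)
qed

lemma c_coeff_block_sizes:
  "c_coeff (block_sizes \<sigma>) = - (\<Prod>\<delta>\<in>\<sigma>. - fact (card \<delta> - 1))"
proof -
  have len: "length (block_sizes \<sigma>) = card \<sigma>"
    by (metis mset_block_sizes size_image_mset size_mset size_mset_set)
  have "(\<Prod>i<length (block_sizes \<sigma>). fact (block_sizes \<sigma> ! i - 1) :: real) =
      prod_list (map (\<lambda>k. fact (k - 1)) (block_sizes \<sigma>))"
    by (simp add: prod.list_conv_set_nth atLeast0LessThan)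
  also have "\<dots> = (\<Prod>\<delta>\<in>\<sigma>. fact (card \<delta> - 1))"
    by (simp add: prod_mset_prod_list[symmetric] mset_block_sizes prod_unfold_prod_mset
        image_mset.compositionality comp_def)
  finally show ?thesis
    by (simp add: c_coeff_def len prod_uminus)
qed

text \<open>
  Collecting set partitions by their block sizes only reorganises the sum, since the coefficient
  and the value of a set partition depend on its blocks alone.
\<close>

lemma E_corr_eq_point_expansion:
  assumes "finite P"
  shows "E_corr P \<mu> n f = - point_expansion P (pmf \<mu>) {1..n} f"
proof -
  have "E_corr P \<mu> n f = (\<Sum>l\<in>int_partitions n.
      \<Sum>\<sigma> | \<sigma> \<in> {\<sigma>. partition_on {1..n} \<sigma>} \<and> block_sizes \<sigma> = l. c_coeff (block_sizes \<sigma>) * E_setpart P \<mu> f \<sigma>)"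
    unfolding E_corr_def E_intpart_def sum_distrib_left by (intro sum.cong) auto
  also have "\<dots> = (\<Sum>\<sigma> | partition_on {1..n} \<sigma>. c_coeff (block_sizes \<sigma>) * E_setpart P \<mu> f \<sigma>)"
    by (rule sum.group)
      (use finite_int_partitions block_sizes_int_partitions in \<open>auto simp: finitely_many_partition_on\<close>)
  also have "\<dots> = (\<Sum>\<sigma> | partition_on {1..n} \<sigma>. - (\<Prod>\<delta>\<in>\<sigma>. cycle_weight P (pmf \<mu>) f \<delta>))"
    by (intro sum.cong refl)
      (simp add: c_coeff_block_sizes E_setpart_def E_block_def avg_def cycle_weight_def
        prod.distrib[symmetric])
  finally show ?thesis
    using point_expansion_eq_partition_sum[OF assms, of "{1..n}" "pmf \<mu>" f]
    by (simp add: sum_negf)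
qed

section \<open>The expansion for power series\<close>

lemma fps_const_prod: "(\<Prod>x\<in>S. fps_const (g x)) = fps_const (\<Prod>x\<in>S. g x :: 'r::comm_ring_1)"
  by (induction S rule: infinite_finite_induct) auto

lemma rising_weight_fps_const:
  fixes m :: "'b \<Rightarrow> 'r::comm_ring_1"
  shows "rising_weight P (\<lambda>A. fps_const (m A)) S c = fps_const (rising_weight P m S c)"
proof -
  have "pochhammer (- fps_const a) n = fps_const (pochhammer (- a) n)" for a :: 'r and n
    by (induction n) (simp_all add: pochhammer_Suc fps_of_nat[symmetric])
  then show ?thesis
    by (simp add: rising_weight_def fps_const_prod)
qed

text \<open>
  Multilinearity in coefficient form: the multiset \<open>X\<close> on \<open>S\<close> records which power of the
  variable is taken from the factor with index \<open>i\<close>, namely \<open>count X i\<close>.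
\<close>

lemma fps_nth_point_expansion:
  fixes m :: "'b \<Rightarrow> 'r::comm_ring_1"
  assumes "finite S"
  shows "fps_nth (point_expansion P (\<lambda>A. fps_const (m A)) S (\<lambda>_. p)) k =
    (\<Sum>X\<in>multisets_of_size S k. point_expansion P m S (\<lambda>i A. fps_nth (p A) (count X i)))"
proof -
  have "fps_nth (point_expansion P (\<lambda>A. fps_const (m A)) S (\<lambda>_. p)) k =
      (\<Sum>c\<in>S \<rightarrow>\<^sub>E P. \<Sum>X\<in>multisets_of_size S k.
         rising_weight P m S c * (\<Prod>i\<in>S. fps_nth (p (c i)) (count X i)))"
    by (simp add: point_expansion_def rising_weight_fps_const fps_sum_nth
        fps_prod_nth'[OF assms] sum_distrib_left)
  then show ?thesis
    unfolding point_expansion_def by (subst sum.swap)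
qed

lemma fps_X_power_dvd_point_expansion:
  fixes p :: "'b \<Rightarrow> 'r::comm_ring_1 fps"
  assumes "\<And>A. A \<in> P \<Longrightarrow> fps_X dvd p A"
  shows "fps_X ^ card S dvd point_expansion P m S (\<lambda>_. p)"
  unfolding point_expansion_def
proof (intro dvd_sum dvd_mult)
  fix c assume "c \<in> S \<rightarrow>\<^sub>E P"
  then have "(\<Prod>i\<in>S. fps_X) dvd (\<Prod>i\<in>S. p (c i))"
    by (intro prod_dvd_prod assms) auto
  then show "fps_X ^ card S dvd (\<Prod>i\<in>S. p (c i))" by simp
qed

lemma fps_deriv_prod:
  fixes g :: "'i \<Rightarrow> 'r::comm_ring_1 fps"
  assumes "finite S"
  shows "fps_deriv (\<Prod>i\<in>S. g i) = (\<Sum>j\<in>S. \<Prod>i\<in>S. if i = j then fps_deriv (g i) else g i)"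
  using assms
proof (induction S rule: finite_induct)
  case (insert x S)
  have "(\<Prod>i\<in>S. if i = x then fps_deriv (g i) else g i) = (\<Prod>i\<in>S. g i)"
    using insert.hyps by (intro prod.cong) auto
  moreover have "(\<Sum>j\<in>S. (if x = j then fps_deriv (g x) else g x) *
        (\<Prod>i\<in>S. if i = j then fps_deriv (g i) else g i)) =
      g x * fps_deriv (\<Prod>i\<in>S. g i)"
    unfolding insert.IH sum_distrib_left using insert.hyps by (intro sum.cong) auto
  ultimately show ?case
    using insert.hyps by (simp add: algebra_simps)
qed simp

text \<open>
  The weights are constant series, so the derivative falls on one factor at a time.
\<close>

lemma fps_deriv_point_expansion:
  fixes m :: "'b \<Rightarrow> 'r::comm_ring_1"
  assumes "finite S"
  shows "fps_deriv (point_expansion P (\<lambda>A. fps_const (m A)) S (\<lambda>_. p)) =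
    (\<Sum>j\<in>S. point_expansion P (\<lambda>A. fps_const (m A)) S ((\<lambda>_. p)(j := \<lambda>A. fps_deriv (p A))))"
proof -
  have "fps_deriv (point_expansion P (\<lambda>A. fps_const (m A)) S (\<lambda>_. p)) =
     (\<Sum>c\<in>S \<rightarrow>\<^sub>E P. \<Sum>j\<in>S. rising_weight P (\<lambda>A. fps_const (m A)) S c *
       (\<Prod>i\<in>S. if i = j then fps_deriv (p (c i)) else p (c i)))"
    by (simp add: point_expansion_def rising_weight_fps_const fps_deriv_sum
        fps_deriv_prod[OF assms] sum_distrib_left)
  also have "\<dots> = (\<Sum>j\<in>S. \<Sum>c\<in>S \<rightarrow>\<^sub>E P. rising_weight P (\<lambda>A. fps_const (m A)) S c *
       (\<Prod>i\<in>S. ((\<lambda>_. p)(j := \<lambda>A. fps_deriv (p A))) i (c i)))"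
    by (subst sum.swap) (intro sum.cong refl arg_cong2[where f = "(*)"] prod.cong, auto)
  finally show ?thesis
    by (simp add: point_expansion_def)
qed

text \<open>
  For constant series \<open>m A\<close>, the part of degree \<open>n\<close> in \<open>p\<close> of \<open>\<Prod> (1 - p(A))\<^bsup>m(A)\<^esup>\<close>.
\<close>

definition homogeneous_part :: "'b set \<Rightarrow> ('b \<Rightarrow> real fps) \<Rightarrow> ('b \<Rightarrow> real fps) \<Rightarrow> nat \<Rightarrow> real fps" where
  "homogeneous_part P m p n = fps_const (1 / fact n) * point_expansion P m {1..n} (\<lambda>_. p)"

text \<open>
  Summation over the cycle through \<open>x\<close>: if it contains \<open>k\<close> further indices, it contributes the
  average of \<open>q p\<^sup>k\<close>, it can be chosen in \<open>n! / (n - k)!\<close> ways, where \<open>n = card S\<close>, and the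
  other \<open>n - k\<close> indices form an unmarked expansion.  In the proof the cycle is built up one index at
  a time, each merge replacing \<open>q\<close> by \<open>q p\<close>.  As \<open>x\<close> is arbitrary, the induction
  hypothesis with \<open>q = p\<close> also shows that the unmarked expansion depends on \<open>card S\<close> only.
\<close>

lemma point_expansion_marked:
  fixes S :: "nat set"
  assumes "finite P" "finite S" "x \<notin> S"
  shows "point_expansion P m (insert x S) ((\<lambda>_. p)(x := q)) =
    - fps_const (fact (card S)) *
      (\<Sum>k\<le>card S. (\<Sum>A\<in>P. m A * (q A * p A ^ k)) * homogeneous_part P m p (card S - k))"
  using assms(2,3)
proof (induction "card S" arbitrary: S x q)
  case 0
  then have "S = {}" by simp
  then show ?case
    using point_expansion_insert[OF assms(1), of "{}" x m "(\<lambda>_. p)(x := q)"]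
    by (simp add: homogeneous_part_def fun_upd_def)
next
  case (Suc n S x q)
  let ?h = "homogeneous_part P m p"
  define a where "a q k = (\<Sum>A\<in>P. m A * (q A * p A ^ k))" for q k
  define R where "R q = - fps_const (fact n) * (\<Sum>k\<le>n. a q k * ?h (n - k))" for q
  have marked: "point_expansion P m T ((\<lambda>_. p)(j := r)) = R r"
    if "finite T" "card T = Suc n" "j \<in> T" for T :: "nat set" and j r
    using Suc.hyps(1)[of "T - {j}" j r] that by (simp add: R_def a_def insert_absorb)
  have const: "point_expansion P m T (\<lambda>_. p) = R p" if "finite T" "card T = Suc n" for T :: "nat set"
  proof -
    from that obtain j where "j \<in> T" by fastforce
    with marked[OF that this, of p] show ?thesis by (simp add: fun_upd_idem)
  qed
  have "point_expansion P m S (\<lambda>_. p) = point_expansion P m {1..Suc n} (\<lambda>_. p)"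
    using const[of S] const[of "{1..Suc n}"] Suc.prems Suc.hyps(2) by simp
  also have "\<dots> = fps_const (fact (Suc n)) * ?h (Suc n)"
    by (simp add: homogeneous_part_def mult.assoc[symmetric] fps_const_mult del: fact_Suc)
  finally have unmarked: "point_expansion P m S (\<lambda>_. p) = fps_const (fact (Suc n)) * ?h (Suc n)" .
  have "point_expansion P m (insert x S) ((\<lambda>_. p)(x := q)) =
      - a q 0 * point_expansion P m S ((\<lambda>_. p)(x := q)) +
      (\<Sum>j\<in>S. point_expansion P m S (((\<lambda>_. p)(x := q))(j := \<lambda>A. ((\<lambda>_. p)(x := q)) x A * ((\<lambda>_. p)(x := q)) j A)))"
    unfolding point_expansion_insert[OF assms(1) Suc.prems] by (simp add: a_def)
  also have "point_expansion P m S ((\<lambda>_. p)(x := q)) = point_expansion P m S (\<lambda>_. p)"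
    by (rule point_expansion_cong) (use Suc.prems in auto)
  also have "(\<Sum>j\<in>S. point_expansion P m S (((\<lambda>_. p)(x := q))(j := \<lambda>A. ((\<lambda>_. p)(x := q)) x A * ((\<lambda>_. p)(x := q)) j A))) =
      (\<Sum>j\<in>S. point_expansion P m S ((\<lambda>_. p)(j := \<lambda>A. q A * p A)))"
    by (intro sum.cong refl point_expansion_cong) (use Suc.prems in auto)
  also have "\<dots> = (\<Sum>j\<in>S. R (\<lambda>A. q A * p A))"
    using marked Suc.prems Suc.hyps(2) by (intro sum.cong refl) simp
  also have "\<dots> = - fps_const (fact (Suc n)) * (\<Sum>k\<le>n. a q (Suc k) * ?h (n - k))"
  proof -
    have "a (\<lambda>A. q A * p A) k = a q (Suc k)" for k
      by (simp add: a_def ac_simps)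
    moreover have "of_nat (Suc n) * fps_const (fact n) = (fps_const (fact (Suc n)) :: real fps)"
      by (simp only: fps_of_nat[symmetric] fps_const_mult fact_Suc)
    moreover have "(\<Sum>j\<in>S. R (\<lambda>A. q A * p A)) =
        - (of_nat (Suc n) * fps_const (fact n)) * (\<Sum>k\<le>n. a (\<lambda>A. q A * p A) k * ?h (n - k))"
      by (simp add: R_def Suc.hyps(2)[symmetric] mult.assoc del: of_nat_Suc fps_const_neg)
    ultimately show ?thesis
      by (simp only:)
  qed
  also have "- a q 0 * point_expansion P m S (\<lambda>_. p)
      + - fps_const (fact (Suc n)) * (\<Sum>k\<le>n. a q (Suc k) * ?h (n - k)) =
      - fps_const (fact (Suc n)) * (\<Sum>k\<le>Suc n. a q k * ?h (Suc n - k))"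
    unfolding unmarked sum.atMost_Suc_shift by (simp add: algebra_simps del: fact_Suc fps_const_neg)
  finally show ?case
    by (simp only: a_def Suc.hyps(2)[symmetric])
qed

text \<open>
  Each of the \<open>n + 1\<close> positions of the derivative is a marked index, with \<open>q\<close> the derivative of
  \<open>p\<close>; the factor \<open>n + 1\<close> turns \<open>n!\<close> into \<open>(n + 1)!\<close> and cancels the normalisation.
\<close>

lemma fps_deriv_homogeneous_part:
  assumes "finite P"
  shows "fps_deriv (homogeneous_part P (\<lambda>A. fps_const (m A)) p (Suc n)) =
    - (\<Sum>k\<le>n. (\<Sum>A\<in>P. fps_const (m A) * (fps_deriv (p A) * p A ^ k)) *
         homogeneous_part P (\<lambda>A. fps_const (m A)) p (n - k))"
proof -
  let ?m = "\<lambda>A. fps_const (m A)"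
  define s where "s = (\<Sum>k\<le>n. (\<Sum>A\<in>P. fps_const (m A) * (fps_deriv (p A) * p A ^ k)) *
         homogeneous_part P ?m p (n - k))"
  have "point_expansion P ?m {1..Suc n} ((\<lambda>_. p)(j := \<lambda>A. fps_deriv (p A))) = - fps_const (fact n) * s"
    if "j \<in> {1..Suc n}" for j
    using point_expansion_marked[OF assms, of "{1..Suc n} - {j}" j ?m p "\<lambda>A. fps_deriv (p A)"] that
    by (simp add: s_def insert_absorb)
  then have "fps_deriv (point_expansion P ?m {1..Suc n} (\<lambda>_. p)) =
      (\<Sum>j\<in>{1..Suc n}. - fps_const (fact n) * s)"
    by (subst fps_deriv_point_expansion) (simp_all del: atLeastAtMost_iff)
  also have "\<dots> = - fps_const (fact (Suc n)) * s"
  proof -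
    have "of_nat (Suc n) * fps_const (fact n) = (fps_const (fact (Suc n)) :: real fps)"
      by (simp only: fps_of_nat[symmetric] fps_const_mult fact_Suc)
    then show ?thesis
      by (simp add: mult.assoc[symmetric] del: fact_Suc of_nat_Suc fps_const_neg)
  qed
  finally have "fps_deriv (homogeneous_part P ?m p (Suc n)) =
      - (fps_const (1 / fact (Suc n)) * fps_const (fact (Suc n))) * s"
    by (simp add: homogeneous_part_def mult.assoc del: fact_Suc fps_const_mult fps_const_neg)
  then show ?thesis
    by (simp add: s_def del: fact_Suc)
qed

section \<open>Differential equation of the product of powers\<close>

lemma fps_nth_eq_0_of_dvd: "fps_X ^ N dvd (f :: 'r::comm_ring_1 fps) \<Longrightarrow> k < N \<Longrightarrow> fps_nth f k = 0"
  by (auto simp: fps_X_power_mult_nth elim: dvdE)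

text \<open>
  The equation \<open>K' = b K\<close> expresses the coefficient \<open>j + 1\<close> of \<open>K\<close> by the coefficients up to \<open>j\<close>, so
  knowing the equation modulo the power \<open>N\<close> of the variable settles the coefficients up to \<open>N\<close>.
\<close>

lemma fps_linear_ode_unique:
  fixes K b :: "real fps"
  assumes "fps_nth K 0 = 0" "fps_X ^ N dvd b * K - fps_deriv K" "k \<le> N"
  shows "fps_nth K k = 0"
  using assms(3)
proof (induction k rule: less_induct)
  case (less k)
  show ?case
  proof (cases k)
    case 0
    then show ?thesis using assms(1) by simp
  next
    case (Suc j)
    have "fps_nth (b * K) j = 0"
      unfolding fps_mult_nth using less Suc by (intro sum.neutral) auto
    with fps_nth_eq_0_of_dvd[OF assms(2), of j] less.prems Suc show ?thesis by simp
  qed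
qed

lemma fps_ln_one_minus_deriv:
  assumes "fps_nth q 0 = 0"
  shows "fps_deriv (fps_ln_one_minus q) = - (fps_deriv q * inverse (1 - q))"
proof -
  have "fps_deriv (Abs_fps (\<lambda>i. if i = 0 then 0 else 1 / real i)) = inverse (1 - fps_X)"
    unfolding fps_inverse_one_minus_fps_X by (rule fps_ext) simp
  moreover have "inverse (1 - fps_X) oo q = inverse (1 - q)"
    using assms by (subst fps_inverse_compose) (simp_all add: fps_compose_sub_distrib)
  ultimately show ?thesis
    using assms by (simp add: fps_ln_one_minus_def fps_compose_deriv mult.commute)
qed

lemma fps_one_minus_powr_nth_0 [simp]: "fps_nth (fps_one_minus_powr q a) 0 = 1"
  by (simp add: fps_one_minus_powr_def)

lemma fps_one_minus_powr_deriv: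
  assumes "fps_nth q 0 = 0"
  shows "fps_deriv (fps_one_minus_powr q a) =
    - (fps_const a * (fps_deriv q * inverse (1 - q))) * fps_one_minus_powr q a"
proof -
  have "fps_nth (fps_const a * fps_ln_one_minus q) 0 = 0"
    by (simp add: fps_ln_one_minus_def)
  then show ?thesis
    using assms by (simp add: fps_one_minus_powr_def fps_compose_deriv fps_ln_one_minus_deriv)
qed

lemma prod_fps_one_minus_powr_deriv:
  assumes "finite P" "\<And>A. A \<in> P \<Longrightarrow> fps_nth (p A) 0 = 0"
  shows "fps_deriv (\<Prod>A\<in>P. fps_one_minus_powr (p A) (m A)) =
    - (\<Sum>A\<in>P. fps_const (m A) * (fps_deriv (p A) * inverse (1 - p A))) *
      (\<Prod>A\<in>P. fps_one_minus_powr (p A) (m A))"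
  using assms
proof (induction P rule: finite_induct)
  case (insert B P)
  define u where "u A = fps_const (m A) * (fps_deriv (p A) * inverse (1 - p A))" for A
  define g where "g A = fps_one_minus_powr (p A) (m A)" for A
  have "fps_deriv (g B) = - u B * g B"
    unfolding g_def u_def by (rule fps_one_minus_powr_deriv) (simp add: insert.prems)
  moreover have "fps_deriv (\<Prod>A\<in>P. g A) = - (\<Sum>A\<in>P. u A) * (\<Prod>A\<in>P. g A)"
    unfolding g_def u_def by (rule insert.IH) (simp add: insert.prems)
  ultimately have "fps_deriv (\<Prod>A\<in>insert B P. g A) =
      - (\<Sum>A\<in>insert B P. u A) * (\<Prod>A\<in>insert B P. g A)"
    using insert.hyps by (simp add: algebra_simps)
  then show ?case
    by (simp only: g_def u_def)
qed simp

text \<open>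
  The product \<open>G\<close> solves \<open>G' = b G\<close>, where \<open>- b\<close> is the average of \<open>p' / (1 - p)\<close>.  Expanding this
  as a geometric series in \<open>p\<close>, the formal sum of the homogeneous parts solves the same
  equation by \<open>fps_deriv_homogeneous_part\<close>.  The parts of degree above \<open>k\<close> in \<open>p\<close> do not reach the
  coefficient \<open>k\<close>, so it suffices to compare \<open>G\<close> with the finite sum \<open>H\<close> of the parts up to degree
  \<open>k\<close>, which solves the equation up to multiples of the power \<open>k\<close> of the variable.
\<close>

lemma fps_nth_prod_one_minus_powr:
  assumes "finite P" "\<And>A. A \<in> P \<Longrightarrow> fps_nth (p A) 0 = 0"
  shows "fps_nth (\<Prod>A\<in>P. fps_one_minus_powr (p A) (m A)) k =
    (\<Sum>n\<le>k. fps_nth (homogeneous_part P (\<lambda>A. fps_const (m A)) p n) k)"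
proof -
  define h where "h = homogeneous_part P (\<lambda>A. fps_const (m A)) p"
  define a where "a k = (\<Sum>A\<in>P. fps_const (m A) * (fps_deriv (p A) * p A ^ k))" for k
  define b where "b = - (\<Sum>A\<in>P. fps_const (m A) * (fps_deriv (p A) * inverse (1 - p A)))"
  define G where "G = (\<Prod>A\<in>P. fps_one_minus_powr (p A) (m A))"
  define H where "H = (\<Sum>n\<le>k. h n)"
  have X_dvd: "fps_X dvd p A" if "A \<in> P" for A
    using assms(2)[OF that]
    by (intro dvdI[of _ _ "fps_shift 1 (p A)"] fps_ext) (simp add: fps_X_mult_nth)
  have h_dvd: "fps_X ^ n dvd h n" for n
  proof -
    have "fps_X ^ card {1..n} dvd point_expansion P (\<lambda>A. fps_const (m A)) {1..n} (\<lambda>_. p)"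
      by (rule fps_X_power_dvd_point_expansion) (rule X_dvd)
    then show ?thesis
      by (simp add: h_def homogeneous_part_def)
  qed
  have h0: "h 0 = 1"
    by (simp add: h_def homogeneous_part_def)
  have G0: "fps_nth G 0 = 1"
    unfolding G_def using assms(1) by (induction P rule: finite_induct) simp_all
  have H0: "fps_nth H 0 = 1"
  proof -
    have "fps_nth (h n) 0 = 0" if "n \<noteq> 0" for n
      using fps_nth_eq_0_of_dvd[OF h_dvd, of 0 n] that by simp
    then have "fps_nth H 0 = (\<Sum>n\<le>k. if n = 0 then 1 else 0)"
      unfolding H_def fps_sum_nth by (intro sum.cong) (auto simp: h0)
    then show ?thesis by simp
  qed
  \<comment> \<open>\<open>- b\<close> is the formal sum of all \<open>a i\<close>; the error of truncation is an average of
    multiples of \<open>p\<^sup>M\<close>.\<close>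
  have b_trunc: "fps_X ^ M dvd b + (\<Sum>i<M. a i)" for M
  proof -
    have geom: "inverse (1 - p A) = (\<Sum>i<M. p A ^ i) + p A ^ M * inverse (1 - p A)" if "A \<in> P" for A
    proof -
      have inv: "inverse (1 - p A) * (1 - p A) = 1"
        using assms(2)[OF that] by (intro inverse_mult_eq_1) simp
      have "inverse (1 - p A) * (1 - p A ^ M) = (\<Sum>i<M. p A ^ i)"
        unfolding one_diff_power_eq by (simp add: mult.assoc[symmetric] inv)
      then show ?thesis by (simp add: algebra_simps)
    qed
    define r where "r = (\<Sum>A\<in>P. fps_const (m A) *
      (fps_deriv (p A) * (p A ^ M * inverse (1 - p A))))"
    have "- b = (\<Sum>A\<in>P. (\<Sum>i<M. fps_const (m A) * (fps_deriv (p A) * p A ^ i)) +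
        fps_const (m A) * (fps_deriv (p A) * (p A ^ M * inverse (1 - p A))))"
      unfolding b_def minus_minus
    proof (rule sum.cong[OF refl])
      fix A assume "A \<in> P"
      show "fps_const (m A) * (fps_deriv (p A) * inverse (1 - p A)) =
        (\<Sum>i<M. fps_const (m A) * (fps_deriv (p A) * p A ^ i)) +
        fps_const (m A) * (fps_deriv (p A) * (p A ^ M * inverse (1 - p A)))"
        by (subst geom[OF \<open>A \<in> P\<close>]) (simp only: distrib_left sum_distrib_left)
    qed
    also have "\<dots> = (\<Sum>i<M. a i) + r"
      unfolding a_def r_def sum.distrib by (subst sum.swap) simp
    finally have "b = - ((\<Sum>i<M. a i) + r)"
      by (metis minus_minus)
    then have "b + (\<Sum>i<M. a i) = - r"
      by simp
    also have "fps_X ^ M dvd - r"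
      unfolding dvd_minus_iff r_def
      by (intro dvd_sum dvd_mult dvd_mult2 dvd_power_same X_dvd)
    finally show ?thesis .
  qed
  have "fps_deriv H = (\<Sum>n<k. fps_deriv (h (Suc n)))"
    unfolding H_def fps_deriv_sum
    by (subst sum.atMost_shift) (simp add: h0)
  also have "\<dots> = - (\<Sum>n<k. \<Sum>i\<le>n. h i * a (n - i))"
  proof -
    have "fps_deriv (h (Suc n)) = - (\<Sum>i\<le>n. h i * a (n - i))" for n
    proof -
      have "(\<Sum>i\<le>n. a i * h (n - i)) = (\<Sum>i\<le>n. h i * a (n - i))"
        by (rule sum.reindex_bij_witness[of _ "\<lambda>i. n - i" "\<lambda>i. n - i"]) (auto simp: mult.commute)
      then show ?thesis
        unfolding h_def fps_deriv_homogeneous_part[OF assms(1)] a_def by (rule arg_cong)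
    qed
    then show ?thesis by (simp add: sum_negf)
  qed
  also have "(\<Sum>n<k. \<Sum>i\<le>n. h i * a (n - i)) = (\<Sum>(i, j)\<in>{(i, j). i + j < k}. h i * a j)"
    by (rule sum.triangle_reindex[symmetric])
  also have "{(i, j). i + j < k} = (SIGMA i:{..k}. {..<k - i})"
    by auto
  also have "(\<Sum>(i, j)\<in>(SIGMA i:{..k}. {..<k - i}). h i * a j) = (\<Sum>i\<le>k. \<Sum>j<k - i. h i * a j)"
    by (simp add: sum.Sigma)
  \<comment> \<open>The part of degree \<open>i\<close> occurs in the derivative of \<open>H\<close> with the terms \<open>a j\<close>, \<open>j < k - i\<close>;
    truncating \<open>b\<close> there costs a multiple of the power \<open>k - i\<close>, and the part itself supplies the
    power \<open>i\<close>.\<close>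
  finally have "b * H - fps_deriv H = (\<Sum>i\<le>k. (b + (\<Sum>j<k - i. a j)) * h i)"
    by (simp add: H_def sum_distrib_left sum_distrib_right sum.distrib algebra_simps)
  also have "fps_X ^ k dvd \<dots>"
  proof (rule dvd_sum)
    fix i assume "i \<in> {..k}"
    then have split: "fps_X ^ k = (fps_X ^ (k - i) * fps_X ^ i :: real fps)"
      by (simp add: power_add[symmetric])
    show "fps_X ^ k dvd (b + (\<Sum>j<k - i. a j)) * h i"
      unfolding split by (rule mult_dvd_mono[OF b_trunc h_dvd])
  qed
  finally have "fps_X ^ k dvd b * H - fps_deriv H" .
  moreover have "fps_deriv G = b * G"
    unfolding G_def b_def using assms by (rule prod_fps_one_minus_powr_deriv)
  ultimately have "fps_X ^ k dvd b * (H - G) - fps_deriv (H - G)"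
    by (simp add: algebra_simps)
  from fps_linear_ode_unique[OF _ this, of k] H0 G0 have "fps_nth G k = fps_nth H k"
    by simp
  then show ?thesis
    by (simp add: G_def H_def h_def fps_sum_nth)
qed

section \<open>Nonnegativity of the coefficients\<close>

theorem all_E_nonneg_imp_coeffs_nonneg:
  fixes P :: "'b::order set"
  assumes "finite P" "all_E_nonneg P \<mu>" "\<forall>i\<ge>1. nonneg_mono_on P (p i)"
  shows "0 \<le> fps_nth (1 - (\<Prod>A\<in>P. fps_one_minus_powr (gen_series p A) (pmf \<mu> A))) k"
proof -
  define h where "h = homogeneous_part P (\<lambda>A. fps_const (pmf \<mu> A)) (gen_series p)"
  have h0: "h 0 = 1"
    by (simp add: h_def homogeneous_part_def)
  have neg: "fps_nth (h n) k \<le> 0" if "n \<ge> 1" for n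
  proof -
    \<comment> \<open>At \<open>count X i = 0\<close> this is the zero function, which is itself nonnegative and monotone, so
      multisets that miss some index need no separate treatment.\<close>
    define f where "f X i A = fps_nth (gen_series p A) (count X i)" for X :: "nat multiset" and i A
    have "nonneg_mono_on P (f X i)" for X i
    proof (cases "count X i = 0")
      case True
      then show ?thesis
        by (simp add: f_def gen_series_def nonneg_mono_on_def mono_on_def)
    next
      case False
      then have "f X i = p (count X i)"
        by (intro ext) (simp only: f_def gen_series_def fps_nth_Abs_fps if_False)
      moreover have "1 \<le> count X i"
        using False by linarith
      ultimately show ?thesis
        using assms(3) by simp
    qed
    then have "0 \<le> E_corr P \<mu> n (f X)" for X
      using assms(2) that by (simp add: all_E_nonneg_def)
    then have "point_expansion P (pmf \<mu>) {1..n} (f X) \<le> 0" for X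
      by (simp add: E_corr_eq_point_expansion[OF assms(1)])
    then have "fps_nth (point_expansion P (\<lambda>A. fps_const (pmf \<mu> A)) {1..n} (\<lambda>_. gen_series p)) k \<le> 0"
      by (simp add: fps_nth_point_expansion f_def[abs_def] sum_nonpos)
    then show ?thesis
      by (simp add: h_def homogeneous_part_def mult_nonneg_nonpos divide_nonpos_pos)
  qed
  have "fps_nth (\<Prod>A\<in>P. fps_one_minus_powr (gen_series p A) (pmf \<mu> A)) k = (\<Sum>n\<le>k. fps_nth (h n) k)"
    unfolding h_def using assms(1) by (rule fps_nth_prod_one_minus_powr) (simp add: gen_series_def)
  also have "\<dots> = fps_nth 1 k + (\<Sum>n<k. fps_nth (h (Suc n)) k)"
    by (subst sum.atMost_shift) (simp add: h0)
  also have "(\<Sum>n<k. fps_nth (h (Suc n)) k) \<le> 0"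
    by (intro sum_nonpos neg) simp
  finally show ?thesis by simp
qed

theorem mainTheorem3:
  shows "(\<forall>(X :: 'a set) (\<mu> :: 'a set pmf) (p :: nat \<Rightarrow> 'a set \<Rightarrow> real).
            finite X \<longrightarrow> set_pmf \<mu> \<subseteq> Pow X \<longrightarrow> all_E_nonneg (Pow X) \<mu> \<longrightarrow>
            (\<forall>i\<ge>1. nonneg_mono_on (Pow X) (p i)) \<longrightarrow>
            (\<forall>k. 0 \<le> fps_nth
               (1 - (\<Prod>A\<in>Pow X. fps_one_minus_powr (gen_series p A) (pmf \<mu> A))) k))
       \<and> (\<forall>(N :: nat) (\<mu> :: nat pmf) (p :: nat \<Rightarrow> nat \<Rightarrow> real).
            1 \<le> N \<longrightarrow> set_pmf \<mu> \<subseteq> {1..N} \<longrightarrow> all_E_nonneg {1..N} \<mu> \<longrightarrow>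
            (\<forall>i\<ge>1. nonneg_mono_on {1..N} (p i)) \<longrightarrow>
            (\<forall>k. 0 \<le> fps_nth
               (1 - (\<Prod>A\<in>{1..N}. fps_one_minus_powr (gen_series p A) (pmf \<mu> A))) k))"
  by (intro conjI allI impI) (rule all_E_nonneg_imp_coeffs_nonneg; simp)+

end
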